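(* Let $G$ be a connected graph with at least four vertices such that $G$ is not complete and $G\neq C_5$. Then $G$ is $\{3P_1,\text{diamond}\}$-free if and only if $\mathrm{diam}(G)\le 3$ and one of the following holds: (i) $V(G)$ is the union of the vertex sets of two cliques $Q_1,Q_2$ and $G$ has exactly one cut vertex; or (ii) $V(G)$ is the disjoint union of two cliques $Q_1,Q_2$ and the edges between $Q_1$ and $Q_2$ form a matching.
   Context: $3P_1$ is the edgeless graph on three vertices; the diamond is $K_4$ minus one edge. $G$ is $\mathcal{F}$-free if it contains no graph of $\mathcal{F}$ as an induced subgraph. $\mathrm{diam}(G)$ is the maximum distance between two vertices of $G$.
   Formalization: In (i) the two cliques are required to share a vertex; with disjoint cliques allowed the claim fails, e.g. for the graph with edges uv, va, vb, ab, ac, bc (cliques {u,v}, {a,b,c}, only cut vertex v, diameter 3, but {v,a,b,c} induces a diamond). *)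

theory Defs
  imports "Graph_Theory.Graph_Theory"
begin

text \<open>Finite simple graphs are \<open>pair_graph\<close>s: finite, loop-free, with a symmetric set of
  arcs, so that an edge \<open>{u, v}\<close> is the pair of arcs \<open>(u, v)\<close>, \<open>(v, u)\<close>.\<close>

definition three_P1 :: "nat pair_pre_digraph" where
  "three_P1 = \<lparr> pverts = {0, 1, 2}, parcs = {} \<rparr>"

definition diamond :: "nat pair_pre_digraph" where
  "diamond = \<lparr> pverts = {0, 1, 2, 3},
     parcs = {(u, v). u \<in> {0, 1, 2, 3} \<and> v \<in> {0, 1, 2, 3} \<and> u \<noteq> v} - {(2, 3), (3, 2)} \<rparr>"

definition C5 :: "nat pair_pre_digraph" where
  "C5 = \<lparr> pverts = {0..<5},
     parcs = {(u, v). u < 5 \<and> v < 5 \<and> (v = (u + 1) mod 5 \<or> u = (v + 1) mod 5)} \<rparr>"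

definition contains_induced :: "('a, 'b) pre_digraph \<Rightarrow> ('c, 'd) pre_digraph \<Rightarrow> bool" where
  "contains_induced G F \<longleftrightarrow> (\<exists>H. induced_subgraph H G \<and> digraph_iso F H)"

definition free_of :: "'c pair_pre_digraph set \<Rightarrow> 'a pair_pre_digraph \<Rightarrow> bool" where
  "free_of \<F> G \<longleftrightarrow> (\<forall>F \<in> \<F>. \<not> contains_induced (with_proj G) (with_proj F))"

text \<open>The distance is the minimum cost of a walk for unit weights. It is \<open>\<infinity>\<close>
  between different components; the supremum is a maximum for finite nonempty graphs.\<close>

definition graph_dist :: "('a, 'b) pre_digraph \<Rightarrow> 'a \<Rightarrow> 'a \<Rightarrow> ereal" where
  "graph_dist G u v = wf_digraph.\<mu> G (\<lambda>_. 1) u v"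

definition diam :: "('a, 'b) pre_digraph \<Rightarrow> ereal" where
  "diam G = (SUP u \<in> verts G. SUP v \<in> verts G. graph_dist G u v)"

definition clique :: "('a, 'b) pre_digraph \<Rightarrow> 'a set \<Rightarrow> bool" where
  "clique G Q \<longleftrightarrow> Q \<subseteq> verts G \<and> (\<forall>u \<in> Q. \<forall>v \<in> Q. u \<noteq> v \<longrightarrow> u \<rightarrow>\<^bsub>G\<^esub> v)"

text \<open>A cut vertex separates two other vertices of its component.\<close>

definition cut_vertex :: "('a, 'b) pre_digraph \<Rightarrow> 'a \<Rightarrow> bool" where
  "cut_vertex G x \<longleftrightarrow> x \<in> verts G \<and>
     (\<exists>u \<in> verts G - {x}. \<exists>v \<in> verts G - {x}.
        u \<rightarrow>\<^sup>*\<^bsub>G\<^esub> v \<and> \<not> u \<rightarrow>\<^sup>*\<^bsub>pre_digraph.del_vert G x\<^esub> v)"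

definition edges_between :: "('a, 'b) pre_digraph \<Rightarrow> 'a set \<Rightarrow> 'a set \<Rightarrow> 'a set set" where
  "edges_between G A B = {{u, v} | u v. u \<in> A \<and> v \<in> B \<and> u \<rightarrow>\<^bsub>G\<^esub> v}"

definition matching :: "'a set set \<Rightarrow> bool" where
  "matching M \<longleftrightarrow> (\<forall>e \<in> M. \<forall>f \<in> M. e \<noteq> f \<longrightarrow> e \<inter> f = {})"

text \<open>When a graph with exactly one cut vertex is described as a union of two cliques, as opposed
  to a disjoint union, the cliques are meant to overlap. Otherwise the edges
  \<open>uv, va, vb, ab, ac, bc\<close> with the cliques \<open>{u, v}\<close>, \<open>{a, b, c}\<close> give such a
  union of diameter 3 with the only cut vertex \<open>v\<close>, although \<open>{v, a, b, c}\<close> induces a diamond.\<close>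

end

theory Submission
  imports Defs
begin

text \<open>In a \<open>{3P\<^sub>1, diamond}\<close>-free graph take nonadjacent vertices \<open>a\<close>, \<open>b\<close>. The non-neighbours
  \<open>A \<ni> a\<close> of \<open>b\<close> and \<open>B \<ni> b\<close> of \<open>a\<close> are cliques, and the common neighbours of \<open>a\<close> and \<open>b\<close>
  are independent, hence at most two. A common neighbour adjacent to a second vertex of \<open>A\<close> is
  adjacent to all of \<open>A\<close>, and likewise for \<open>B\<close>; so the common neighbours can be distributed over
  \<open>A\<close> and \<open>B\<close>, unless there is an induced 5-cycle, which no further vertex can extend. This
  covers the graph by two disjoint cliques without using odd cycles of the complement. If a vertex
  of one clique has two neighbours in the other, it is adjacent to all of it, and diamond-freeness
  leaves no other edge between the cliques: this vertex is the only cut vertex.\<close>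

section \<open>Induced subgraphs as embeddings of vertices\<close>

text \<open>An isomorphism record also has an arc map and new tail and head functions. Since arcs
  are pairs here, a vertex map \<open>f\<close> leaves only \<open>map_prod f f\<close> with the
  projections.\<close>

lemma digraph_iso_with_projI:
  assumes F: "pair_wf_digraph F" and H: "pair_wf_digraph H"
    and bij: "bij_betw f (pverts F) (pverts H)"
    and arcs: "\<And>u v. u \<in> pverts F \<Longrightarrow> v \<in> pverts F \<Longrightarrow>
      (u, v) \<in> parcs F \<longleftrightarrow> (f u, f v) \<in> parcs H"
  shows "digraph_iso (with_proj F) (with_proj H)"
proof -
  interpret F: pair_wf_digraph F by fact
  interpret H: pair_wf_digraph H by fact
  let ?h = "\<lparr>iso_verts = f, iso_arcs = map_prod f f, iso_head = snd, iso_tail = fst\<rparr>"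
  have sub: "parcs F \<subseteq> pverts F \<times> pverts F" "parcs H \<subseteq> pverts H \<times> pverts H"
    using F.wellformed' H.wellformed' by auto
  have inj: "inj_on f (pverts F)" and im: "f ` pverts F = pverts H"
    using bij by (auto simp: bij_betw_def)
  have "inj_on (map_prod f f) (parcs F)"
    using map_prod_inj_on[OF inj inj] sub(1) by (rule inj_on_subset)
  then have "pre_digraph.digraph_isomorphism (with_proj F) ?h"
    unfolding pre_digraph.digraph_isomorphism_def
    using inj F.wf_digraph_axioms by simp
  moreover have "map_prod f f ` parcs F = parcs H"
  proof (intro equalityI subsetI)
    fix e assume "e \<in> map_prod f f ` parcs F"
    then show "e \<in> parcs H" using arcs sub(1) by auto
  next
    fix e assume e: "e \<in> parcs H"
    then obtain u v where "u \<in> pverts F" "v \<in> pverts F" "e = (f u, f v)"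
      using sub(2) im by (cases e) blast
    then show "e \<in> map_prod f f ` parcs F" using e arcs by force
  qed
  ultimately show ?thesis
    unfolding digraph_iso_def app_iso_def using im
    by (intro exI[of _ ?h]) (simp add: with_proj_def)
qed

text \<open>Reduces containment to adjacency, so that the rest of the proof can argue about vertices
  alone. From right to left, the witness is the image of \<open>f\<close> with all arcs of
  \<open>G\<close> inside it.\<close>

lemma contains_induced_with_proj_iff:
  assumes F: "pair_wf_digraph F" and G: "pair_wf_digraph G"
  shows "contains_induced (with_proj G) (with_proj F) \<longleftrightarrow>
    (\<exists>f. inj_on f (pverts F) \<and> f ` pverts F \<subseteq> pverts G \<and>
      (\<forall>u \<in> pverts F. \<forall>v \<in> pverts F. (u, v) \<in> parcs F \<longleftrightarrow> (f u, f v) \<in> parcs G))"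
    (is "_ \<longleftrightarrow> (\<exists>f. ?P f)")
proof
  interpret F: pair_wf_digraph F by fact
  assume "contains_induced (with_proj G) (with_proj F)"
  then obtain h where
    sub: "induced_subgraph (app_iso h (with_proj F)) (with_proj G)" and
    iso: "pre_digraph.digraph_isomorphism (with_proj F) h"
    by (auto simp: contains_induced_def digraph_iso_def)
  let ?f = "iso_verts h"
  \<comment> \<open>Compatibility with \<open>G\<close> forces the new tail and head to be the
    projections, so the arc map is determined by the vertex map.\<close>
  from sub have im: "?f ` pverts F \<subseteq> pverts G" and
    proj: "iso_tail h = fst" "iso_head h = snd" and
    arcs: "iso_arcs h ` parcs F =
      {e \<in> parcs G. fst e \<in> ?f ` pverts F \<and> snd e \<in> ?f ` pverts F}"
    by (auto simp: induced_subgraph_def subgraph_def compatible_def)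
  from iso have inj: "inj_on ?f (pverts F)" and
    ends: "\<And>a. a \<in> parcs F \<Longrightarrow> iso_arcs h a = (?f (fst a), ?f (snd a))"
    by (auto simp: pre_digraph.digraph_isomorphism_def proj prod_eq_iff)
  have "(u, v) \<in> parcs F \<longleftrightarrow> (?f u, ?f v) \<in> parcs G"
    if uv: "u \<in> pverts F" "v \<in> pverts F" for u v
  proof
    assume uv: "(u, v) \<in> parcs F"
    then have "iso_arcs h (u, v) \<in> parcs G"
      using arcs by blast
    moreover have "iso_arcs h (u, v) = (?f u, ?f v)"
      using ends uv by force
    ultimately
    show "(?f u, ?f v) \<in> parcs G" by simp
  next
    assume "(?f u, ?f v) \<in> parcs G"
    then have "(?f u, ?f v) \<in> iso_arcs h ` parcs F" using arcs uv by auto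
    then obtain u' v' where a: "(u', v') \<in> parcs F" "?f u = ?f u'" "?f v = ?f v'"
      using ends by force
    then have "u = u'" "v = v'"
      using inj uv F.wellformed' by (auto simp: inj_on_eq_iff)
    then show "(u, v) \<in> parcs F" using a by simp
  qed
  with inj im show "\<exists>f. ?P f" by blast
next
  interpret G: pair_wf_digraph G by fact
  assume "\<exists>f. ?P f"
  then obtain f where f: "?P f" by blast
  let ?H = "\<lparr>pverts = f ` pverts F, parcs = parcs G \<inter> (f ` pverts F \<times> f ` pverts F)\<rparr>"
  have wf: "pair_wf_digraph ?H" by unfold_locales auto
  then have "digraph_iso (with_proj F) (with_proj ?H)"
    using f F by (intro digraph_iso_with_projI[where f = f]) (auto simp: bij_betw_def)
  moreover have "induced_subgraph (with_proj ?H) (with_proj G)"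
    using f G.wf_digraph_axioms wf[folded wf_digraph_wp_iff]
    by (auto simp: induced_subgraph_def subgraph_def compatible_def)
  ultimately show "contains_induced (with_proj G) (with_proj F)"
    unfolding contains_induced_def by blast
qed

context pair_graph
begin

abbreviation adj :: "'a \<Rightarrow> 'a \<Rightarrow> bool" (infix "\<sim>" 50) where
  "u \<sim> v \<equiv> (u, v) \<in> parcs G"

lemma contains_three_P1_iff:
  "contains_induced (with_proj G) (with_proj three_P1) \<longleftrightarrow>
    (\<exists>x \<in> pverts G. \<exists>y \<in> pverts G. \<exists>z \<in> pverts G. x \<noteq> y \<and> x \<noteq> z \<and> y \<noteq> z \<and>
      \<not> x \<sim> y \<and> \<not> x \<sim> z \<and> \<not> y \<sim> z)"
    (is "?L \<longleftrightarrow> ?R")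
proof -
  have wf: "pair_wf_digraph three_P1" by unfold_locales (auto simp: three_P1_def)
  note iff = contains_induced_with_proj_iff[OF wf pair_wf_digraph]
  show ?thesis
  proof
    assume ?L
    then obtain f :: "nat \<Rightarrow> 'a" where "inj_on f {0, 1, 2}" "f ` {0, 1, 2} \<subseteq> pverts G"
      "\<forall>u \<in> {0, 1, 2}. \<forall>v \<in> {0, 1, 2}. \<not> f u \<sim> f v"
      unfolding iff by (auto simp: three_P1_def)
    then show ?R
      by (intro bexI[of _ "f 0"] bexI[of _ "f 1"] bexI[of _ "f 2"]) auto
  next
    assume ?R
    then obtain x y z where "x \<in> pverts G" "y \<in> pverts G" "z \<in> pverts G"
      "x \<noteq> y" "x \<noteq> z" "y \<noteq> z" "\<not> x \<sim> y" "\<not> x \<sim> z" "\<not> y \<sim> z"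
      by blast
    moreover from this have "\<not> y \<sim> x" "\<not> z \<sim> x" "\<not> z \<sim> y"
      by (auto dest: arcs_symmetric)
    moreover have "\<not> x \<sim> x" "\<not> y \<sim> y" "\<not> z \<sim> z"
      by (auto dest: no_loops')
    ultimately show ?L
      unfolding iff
      by (intro exI[of _ "\<lambda>i. if i = 0 then x else if i = 1 then y else z"])
        (simp add: three_P1_def)
  qed
qed

text \<open>The pair \<open>x\<close>, \<open>y\<close> is the edge joining the two vertices of
  degree 3. Only \<open>u \<noteq> v\<close> has to be stated; the other vertices are distinct
  because they are adjacent and there are no loops.\<close>

lemma contains_diamond_iff:
  "contains_induced (with_proj G) (with_proj diamond) \<longleftrightarrow>
    (\<exists>x y u v. x \<sim> y \<and> x \<sim> u \<and> x \<sim> v \<and> y \<sim> u \<and> y \<sim> v \<and> u \<noteq> v \<and> \<not> u \<sim> v)"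
    (is "?L \<longleftrightarrow> ?R")
proof -
  have wf: "pair_wf_digraph diamond" by unfold_locales (auto simp: diamond_def)
  note iff = contains_induced_with_proj_iff[OF wf pair_wf_digraph]
  show ?thesis
  proof
    assume ?L
    then obtain f where f: "inj_on f (pverts diamond)"
      "\<forall>u \<in> pverts diamond. \<forall>v \<in> pverts diamond. (u, v) \<in> parcs diamond \<longleftrightarrow> f u \<sim> f v"
      unfolding iff by blast
    then show ?R
      by (intro exI[of _ "f 0"] exI[of _ "f 1"] exI[of _ "f 2"] exI[of _ "f 3"])
        (auto simp: diamond_def inj_on_def)
  next
    assume ?R
    then obtain x y u v where *: "x \<sim> y" "x \<sim> u" "x \<sim> v" "y \<sim> u" "y \<sim> v" "u \<noteq> v" "\<not> u \<sim> v"
      by blast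
    then have *: "x \<sim> y" "x \<sim> u" "x \<sim> v" "y \<sim> u" "y \<sim> v" "\<not> u \<sim> v"
      "y \<sim> x" "u \<sim> x" "v \<sim> x" "u \<sim> y" "v \<sim> y" "\<not> v \<sim> u" "u \<noteq> v"
      by (auto dest: arcs_symmetric)
    have "\<not> w \<sim> w" for w by (auto dest: no_loops')
    moreover have "x \<in> pverts G" "y \<in> pverts G" "u \<in> pverts G" "v \<in> pverts G"
      using * by (auto dest: wellformed')
    moreover have "x \<noteq> y" "x \<noteq> u" "x \<noteq> v" "y \<noteq> u" "y \<noteq> v"
      using * by (auto dest: no_loops')
    ultimately show ?L
      using *
      unfolding iff
      by (intro exI[of _ "\<lambda>i. if i = 0 then x else if i = 1 then y else if i = 2 then u else v"])
        (simp add: diamond_def)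
  qed
qed

lemma C5_isoI:
  assumes V: "pverts G = {a, b, c, d, e}"
    and E: "a \<sim> b" "b \<sim> c" "c \<sim> d" "d \<sim> e" "e \<sim> a"
    and N: "\<not> a \<sim> c" "\<not> a \<sim> d" "\<not> b \<sim> d" "\<not> b \<sim> e" "\<not> c \<sim> e"
  shows "digraph_iso (with_proj C5) (with_proj G)"
proof (rule digraph_iso_with_projI)
  let ?f = "\<lambda>i::nat. if i = 0 then a else if i = 1 then b else if i = 2 then c
    else if i = 3 then d else e"
  have S: "{0..<5} = {0, 1, 2, 3, 4::nat}" by auto
  have E': "b \<sim> a" "c \<sim> b" "d \<sim> c" "e \<sim> d" "a \<sim> e"
    and N': "\<not> c \<sim> a" "\<not> d \<sim> a" "\<not> d \<sim> b" "\<not> e \<sim> b" "\<not> e \<sim> c"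
    using E N by (auto dest: arcs_symmetric)
  have L: "\<not> a \<sim> a" "\<not> b \<sim> b" "\<not> c \<sim> c" "\<not> d \<sim> d" "\<not> e \<sim> e"
    by (auto dest: no_loops')
  \<comment> \<open>Neighbours differ as there are no loops; two nonadjacent vertices differ because
    some vertex of the cycle is adjacent to exactly one of them.\<close>
  have "distinct [a, b, c, d, e]"
    using E E' N N' L by auto
  then show "bij_betw ?f (pverts C5) (pverts G)"
    unfolding V C5_def by (simp add: S bij_betw_def insert_commute)
  show "(u, v) \<in> parcs C5 \<longleftrightarrow> ?f u \<sim> ?f v" if "u \<in> pverts C5" "v \<in> pverts C5" for u v
  proof -
    have "u \<in> {0, 1, 2, 3, 4}" "v \<in> {0, 1, 2, 3, 4}"
      using that by (auto simp: C5_def S)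
    then show ?thesis
      using E E' N N' L by (elim insertE emptyE) (simp_all add: C5_def)
  qed
  show "pair_wf_digraph C5" by unfold_locales (auto simp: C5_def)
qed (rule pair_wf_digraph)

section \<open>Cliques and matchings in terms of adjacency\<close>

lemma clique_iff:
  "clique (with_proj G) Q \<longleftrightarrow> Q \<subseteq> pverts G \<and> (\<forall>u \<in> Q. \<forall>v \<in> Q. u \<noteq> v \<longrightarrow> u \<sim> v)"
  by (simp add: clique_def)

text \<open>As \<open>Q1\<close> and \<open>Q2\<close> are disjoint, an edge determines its end on
  each side, and two edges can meet only in ends on the same side.\<close>

lemma matching_edges_between_iff:
  assumes "Q1 \<inter> Q2 = {}"
  shows "matching (edges_between (with_proj G) Q1 Q2) \<longleftrightarrow>
    (\<forall>u \<in> Q1. \<forall>u' \<in> Q1. \<forall>v \<in> Q2. \<forall>v' \<in> Q2. u \<sim> v \<longrightarrow> u' \<sim> v' \<longrightarrow> (u = u' \<longleftrightarrow> v = v'))"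
    (is "?L \<longleftrightarrow> ?R")
proof
  assume L: ?L
  show ?R
  proof (intro ballI impI)
    fix u u' v v'
    assume uv: "u \<in> Q1" "u' \<in> Q1" "v \<in> Q2" "v' \<in> Q2" "u \<sim> v" "u' \<sim> v'"
    then have "{u, v} \<in> edges_between (with_proj G) Q1 Q2"
      "{u', v'} \<in> edges_between (with_proj G) Q1 Q2"
      by (auto simp: edges_between_def)
    with L have "{u, v} = {u', v'} \<or> {u, v} \<inter> {u', v'} = {}"
      unfolding matching_def by meson
    then show "u = u' \<longleftrightarrow> v = v'"
      using uv assms by (auto simp: doubleton_eq_iff)
  qed
next
  assume R: ?R
  show ?L
    unfolding matching_def
  proof (intro ballI impI)
    fix e f
    assume ef: "e \<in> edges_between (with_proj G) Q1 Q2" "f \<in> edges_between (with_proj G) Q1 Q2"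
      and ne: "e \<noteq> f"
    then obtain u v u' v' where uv: "e = {u, v}" "f = {u', v'}"
      "u \<in> Q1" "u' \<in> Q1" "v \<in> Q2" "v' \<in> Q2" "u \<sim> v" "u' \<sim> v'"
      by (auto simp: edges_between_def)
    moreover from this R have "u = u' \<longleftrightarrow> v = v'" by blast
    ultimately show "e \<inter> f = {}" using ne assms by auto
  qed
qed

section \<open>Connectedness and the diameter bound\<close>

text \<open>A walk from \<open>a\<close> to \<open>b\<close> either uses an arc from
  \<open>Q1\<close> to \<open>Q2\<close> or ends inside \<open>Q1\<close>, and then \<open>b\<close>
  lies in both sets.\<close>

lemma connected_imp_edge_between:
  assumes "Digraph_Component.connected (with_proj G)"
    and V: "pverts G = Q1 \<union> Q2" and ab: "a \<in> Q1" "b \<in> Q2"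
  obtains "Q1 \<inter> Q2 \<noteq> {}" | p q where "p \<in> Q1" "q \<in> Q2" "p \<sim> q"
proof -
  have "strongly_connected (with_proj G)"
    using symmetric_connected_imp_strongly_connected[OF pair_sym_arcs assms(1)] .
  then have "a \<rightarrow>\<^sup>*\<^bsub>with_proj G\<^esub> b" using V ab by (auto simp: strongly_connected_def)
  then have "b \<in> Q1 \<or> (\<exists>p \<in> Q1. \<exists>q \<in> Q2. p \<sim> q)"
  proof (induction rule: reachable_induct)
    case base
    then show ?case using ab by simp
  next
    case (step x y)
    then show ?case using V wellformed'(2)[of x y] by auto
  qed
  then show ?thesis using that ab by blast
qed

lemma diam_leI:
  assumes "\<And>u v. u \<in> pverts G \<Longrightarrow> v \<in> pverts G \<Longrightarrow> \<exists>p. awalk u p v \<and> length p \<le> n"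
  shows "diam (with_proj G) \<le> n"
  unfolding diam_def
proof (intro SUP_least)
  fix u v assume "u \<in> verts (with_proj G)" "v \<in> verts (with_proj G)"
  then obtain p where p: "awalk u p v" "length p \<le> n" using assms by auto
  have "awalk_cost (\<lambda>_. 1) p = length p"
    by (induction p) (auto simp: awalk_cost_def)
  with p show "graph_dist (with_proj G) u v \<le> n"
    unfolding graph_dist_def using min_cost_le_walk_cost[OF p(1), of "\<lambda>_. 1"]
    by (metis (no_types, lifting) ereal_less_eq(3) of_nat_le_iff order_trans)
qed

text \<open>One step inside the first clique, at most one step across, and one step inside the
  second.\<close>

lemma diam_le_3_if_two_cliques:
  assumes conn: "Digraph_Component.connected (with_proj G)"
    and Q: "clique (with_proj G) Q1" "clique (with_proj G) Q2"
    and V: "pverts G = Q1 \<union> Q2"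
  shows "diam (with_proj G) \<le> 3"
proof -
  have near: "\<exists>p. awalk u p v \<and> length p \<le> 1"
    if "clique (with_proj G) Q" "u \<in> Q" "v \<in> Q" for Q u v
  proof (cases "u = v")
    case True
    then show ?thesis
      using that by (intro exI[of _ "[]"]) (auto simp: clique_iff awalk_Nil_iff)
  next
    case False
    then have "u \<sim> v" using that by (auto simp: clique_iff)
    then show ?thesis
      by (intro exI[of _ "[(u, v)]"]) (auto simp: awalk_simps dest: wellformed')
  qed
  have far: "\<exists>p. awalk u p v \<and> length p \<le> 3" if uv: "u \<in> Q1" "v \<in> Q2" for u v
  proof -
    \<comment> \<open>The crossing part of the walk; \<open>x\<close> and \<open>y\<close> are taken
      to be the same vertex when the cliques overlap.\<close>
    obtain x y r where xy: "x \<in> Q1" "y \<in> Q2" "awalk x r y" "length r \<le> 1"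
    proof (rule connected_imp_edge_between[OF conn V uv])
      assume "Q1 \<inter> Q2 \<noteq> {}"
      then obtain z where "z \<in> Q1" "z \<in> Q2" by blast
      then show ?thesis using that near[OF Q(1), of z z] by blast
    next
      fix x y assume "x \<in> Q1" "y \<in> Q2" "x \<sim> y"
      then show ?thesis
        using that[of x y "[(x, y)]"] by (auto simp: awalk_simps dest: wellformed')
    qed
    obtain s t where "awalk u s x" "length s \<le> 1" "awalk y t v" "length t \<le> 1"
      using near[OF Q(1) uv(1) xy(1)] near[OF Q(2) xy(2) uv(2)] by blast
    with xy show ?thesis
      by (intro exI[of _ "s @ r @ t"]) (auto intro!: awalk_appendI)
  qed
  have "\<exists>p. awalk u p v \<and> length p \<le> 3" if uv: "u \<in> pverts G" "v \<in> pverts G" for u v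
  proof -
    have rev: "length (rev_path p) = length p" for p :: "('a \<times> 'a) list"
      by (induction p) auto
    consider "u \<in> Q1" "v \<in> Q1" | "u \<in> Q2" "v \<in> Q2" | "u \<in> Q1" "v \<in> Q2" | "v \<in> Q1" "u \<in> Q2"
      using uv V by blast
    then show ?thesis
    proof cases
      case 1
      then show ?thesis using near[OF Q(1)] by fastforce
    next
      case 2
      then show ?thesis using near[OF Q(2)] by fastforce
    next
      case 3
      then show ?thesis by (rule far)
    next
      case 4
      then obtain p where "awalk v p u" "length p \<le> 3" using far by blast
      then show ?thesis by (intro exI[of _ "rev_path p"]) (simp add: rev)
    qed
  qed
  then show ?thesis using diam_leI[of 3] by simp
qed

section \<open>Vertex deletion and cut vertices\<close>

lemma adj_del_vert_iff:
  "u \<rightarrow>\<^bsub>del_vert x\<^esub> v \<longleftrightarrow> u \<sim> v \<and> u \<noteq> x \<and> v \<noteq> x"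
  by (force simp: arcs_ends_conv arcs_del_vert tail_del_vert head_del_vert)

text \<open>Deleting any vertex other than \<open>z\<close> leaves every remaining vertex joined to
  \<open>z\<close>, so nothing is separated.\<close>

lemma dominating_vertex_imp_only_cut_vertex:
  assumes z: "\<And>u. u \<in> pverts G \<Longrightarrow> u \<noteq> z \<Longrightarrow> u \<sim> z"
    and cut: "cut_vertex (with_proj G) x"
  shows "x = z"
proof (rule ccontr)
  assume "x \<noteq> z"
  interpret D: wf_digraph "del_vert x" by (rule wf_digraph_del_vert)
  obtain u v where uv: "u \<in> pverts G" "u \<noteq> x" "v \<in> pverts G" "v \<noteq> x"
    "\<not> u \<rightarrow>\<^sup>*\<^bsub>del_vert x\<^esub> v"
    using cut by (auto simp: cut_vertex_def)
  have "w \<rightarrow>\<^sup>*\<^bsub>del_vert x\<^esub> z \<and> z \<rightarrow>\<^sup>*\<^bsub>del_vert x\<^esub> w"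
    if "w \<in> pverts G" "w \<noteq> x" for w
  proof (cases "w = z")
    case True
    then show ?thesis using that by (auto simp: verts_del_vert)
  next
    case False
    then have "w \<sim> z" "z \<sim> w" using z that by (auto intro: arcs_symmetric)
    then show ?thesis
      using that \<open>x \<noteq> z\<close> by (auto intro!: D.reachable_adjI simp: adj_del_vert_iff)
  qed
  then show False using uv D.reachable_trans by blast
qed

end

section \<open>Structure of graphs without induced \<open>three_P1\<close> and
  \<open>diamond\<close>\<close>

text \<open>The two exclusions are phrased as rules that produce edges, the form in which they are
  applied; \<open>free_of_iff\<close> links them to \<open>free_of\<close>.\<close>

locale three_P1_diamond_free = pair_graph +
  assumes three_P1: "\<lbrakk>x \<in> pverts G; y \<in> pverts G; z \<in> pverts G; x \<noteq> y; x \<noteq> z; y \<noteq> z\<rbrakk>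
      \<Longrightarrow> x \<sim> y \<or> x \<sim> z \<or> y \<sim> z"
    and diamond: "\<lbrakk>x \<sim> y; x \<sim> u; x \<sim> v; y \<sim> u; y \<sim> v; u \<noteq> v\<rbrakk> \<Longrightarrow> u \<sim> v"

lemma (in pair_graph) free_of_iff:
  "free_of {three_P1, diamond} G \<longleftrightarrow> three_P1_diamond_free G"
  unfolding free_of_def three_P1_diamond_free_def three_P1_diamond_free_axioms_def
  using pair_graph by (simp add: contains_three_P1_iff contains_diamond_iff) meson

context three_P1_diamond_free
begin

text \<open>A vertex \<open>w\<close> off the cycle sees one of any two nonadjacent cycle vertices,
  so it misses at most two, and these are consecutive. Hence it sees three consecutive ones and
  forms a diamond with them.\<close>

lemma induced_C5_imp_iso:
  assumes E: "a \<sim> b" "b \<sim> c" "c \<sim> d" "d \<sim> e" "e \<sim> a"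
    and N: "\<not> a \<sim> c" "\<not> a \<sim> d" "\<not> b \<sim> d" "\<not> b \<sim> e" "\<not> c \<sim> e"
  shows "digraph_iso (with_proj C5) (with_proj G)"
proof -
  have E': "b \<sim> a" "c \<sim> b" "d \<sim> c" "e \<sim> d" "a \<sim> e"
    using E by (auto dest: arcs_symmetric)
  have V: "a \<in> pverts G" "b \<in> pverts G" "c \<in> pverts G" "d \<in> pverts G" "e \<in> pverts G"
    using E by (auto dest: wellformed')
  have ne: "a \<noteq> c" "a \<noteq> d" "b \<noteq> d" "b \<noteq> e" "c \<noteq> e"
    using E N E' by auto
  have "w \<in> {a, b, c, d, e}" if w: "w \<in> pverts G" for w
  proof (rule ccontr)
    assume "w \<notin> {a, b, c, d, e}"
    then have "w \<noteq> a" "w \<noteq> b" "w \<noteq> c" "w \<noteq> d" "w \<noteq> e" by auto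
    then have "w \<sim> a \<or> w \<sim> c" "w \<sim> a \<or> w \<sim> d" "w \<sim> b \<or> w \<sim> d" "w \<sim> b \<or> w \<sim> e" "w \<sim> c \<or> w \<sim> e"
      using three_P1[OF w] V N ne by blast+
    moreover have "\<not> (w \<sim> a \<and> w \<sim> b \<and> w \<sim> c)" using diamond[of w b a c] E E' N ne by blast
    moreover have "\<not> (w \<sim> b \<and> w \<sim> c \<and> w \<sim> d)" using diamond[of w c b d] E E' N ne by blast
    moreover have "\<not> (w \<sim> c \<and> w \<sim> d \<and> w \<sim> e)" using diamond[of w d c e] E E' N ne by blast
    moreover have "\<not> (w \<sim> d \<and> w \<sim> e \<and> w \<sim> a)" using diamond[of w e a d] E E' N ne by blast
    moreover have "\<not> (w \<sim> e \<and> w \<sim> a \<and> w \<sim> b)" using diamond[of w a b e] E E' N ne by blast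
    ultimately show False by argo
  qed
  with V have "pverts G = {a, b, c, d, e}" by blast
  then show ?thesis using E N by (rule C5_isoI)
qed

text \<open>The edge \<open>pq\<close> has \<open>x\<close> and \<open>r\<close> as common
  neighbours, so diamond-freeness makes these adjacent: two neighbours in a clique propagate to the
  whole clique.\<close>

lemma clique_extend:
  assumes Q: "clique (with_proj G) Q" and pq: "p \<in> Q" "q \<in> Q" "p \<noteq> q" "x \<sim> p" "x \<sim> q"
    and r: "r \<in> Q" "r \<noteq> x"
  shows "x \<sim> r"
proof (cases "r = p \<or> r = q")
  case True
  then show ?thesis using pq by blast
next
  case False
  have "p \<sim> q" "p \<sim> r" "q \<sim> r" "p \<sim> x" "q \<sim> x"
    using Q pq r False by (auto simp: clique_iff intro: arcs_symmetric)
  then show ?thesis using diamond r by blast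
qed

lemma two_cliques:
  assumes ab: "a \<in> pverts G" "b \<in> pverts G" "a \<noteq> b" "\<not> a \<sim> b"
    and C5: "\<not> digraph_iso (with_proj C5) (with_proj G)"
  obtains Q1 Q2 where "clique (with_proj G) Q1" "clique (with_proj G) Q2"
    "pverts G = Q1 \<union> Q2" "Q1 \<inter> Q2 = {}" "a \<in> Q1" "b \<in> Q2"
proof -
  define A where "A = {x \<in> pverts G. x \<noteq> b \<and> \<not> x \<sim> b}"
  define B where "B = {x \<in> pverts G. x \<noteq> a \<and> \<not> x \<sim> a}"
  define C where "C = {x. x \<sim> a \<and> x \<sim> b}"
  have sym: "u \<sim> v \<longleftrightarrow> v \<sim> u" for u v by (blast intro: arcs_symmetric)
  have irr: "\<not> u \<sim> u" for u by (auto dest: no_loops')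
  have aA: "a \<in> A" "a \<notin> B" "b \<in> B" "b \<notin> A" "a \<notin> C" "b \<notin> C"
    using ab sym irr by (auto simp: A_def B_def C_def)
  have AB: "A \<inter> B = {}" "A \<inter> C = {}" "B \<inter> C = {}"
    using three_P1[of a b] ab sym by (auto simp: A_def B_def C_def)
  have V: "pverts G = A \<union> B \<union> C"
    using ab irr sym by (auto simp: A_def B_def C_def dest: wellformed')
  \<comment> \<open>Two nonadjacent vertices of \<open>A\<close> would form an independent triple
    with \<open>b\<close>; likewise for \<open>B\<close> and \<open>a\<close>.\<close>
  have A: "clique (with_proj G) A" and B: "clique (with_proj G) B"
    using three_P1 ab unfolding clique_iff A_def B_def by blast+
  \<comment> \<open>An edge inside \<open>C\<close> would have the nonadjacent common neighbours
    \<open>a\<close> and \<open>b\<close>.\<close>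
  have CC: "\<not> c \<sim> d" if "c \<in> C" "d \<in> C" for c d
    using diamond[of c d a b] that ab sym by (auto simp: C_def)
  have Ca: "c \<sim> a" "c \<sim> b" if "c \<in> C" for c using that by (auto simp: C_def)
  have extend: "clique (with_proj G) (insert c Q)"
    if "clique (with_proj G) Q" "c \<in> C" "\<And>x. x \<in> Q \<Longrightarrow> c \<sim> x" for Q c
    using that sym V by (auto simp: clique_iff)
  have dichotomy: "(\<forall>x \<in> Q. c \<sim> x) \<or> (\<forall>x \<in> Q - {q}. \<not> c \<sim> x)"
    if "clique (with_proj G) Q" "q \<in> Q" "c \<sim> q" "c \<notin> Q" for Q q c
    using clique_extend[OF that(1,2) _ _ that(3)] that by blast
  note dichA = dichotomy[OF A aA(1)] and dichB = dichotomy[OF B aA(3)]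
  have notin: "c \<notin> A" "c \<notin> B" if "c \<in> C" for c using AB that by auto
  consider (0) "C = {}" | (1) c where "C = {c}" | (2) c d where "c \<in> C" "d \<in> C" "c \<noteq> d"
    by blast
  then show ?thesis
  proof cases
    case 0
    then show ?thesis using that[of A B] A B AB V aA by simp
  next
    case (1 c)
    then have c: "c \<in> C" by simp
    have "(\<forall>x \<in> A. c \<sim> x) \<or> (\<forall>x \<in> B. c \<sim> x)"
    proof (rule ccontr)
      assume neg: "\<not> ?thesis"
      then obtain x y where xy: "x \<in> A" "y \<in> B" "\<not> c \<sim> x" "\<not> c \<sim> y" by blast
      then have ne: "x \<noteq> a" "y \<noteq> b" "x \<noteq> y" "x \<noteq> c" "y \<noteq> c"
        using Ca[OF c] AB notin[OF c] by blast+
      have "x \<sim> y" using three_P1[of x y c] xy ne V c sym by blast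
      moreover have "a \<sim> x" "b \<sim> y"
        using A B xy aA ne by (auto simp: clique_iff)
      moreover have "\<not> x \<sim> b" "\<not> y \<sim> a" using xy by (auto simp: A_def B_def)
      \<comment> \<open>The induced 5-cycle is \<open>x\<close>, \<open>a\<close>, \<open>c\<close>,
        \<open>b\<close>, \<open>y\<close>.\<close>
      ultimately have "digraph_iso (with_proj C5) (with_proj G)"
        using induced_C5_imp_iso[of x a c b y] xy Ca[OF c] ab sym by blast
      with C5 show False by blast
    qed
    then show ?thesis
    proof
      assume "\<forall>x \<in> A. c \<sim> x"
      then show ?thesis
        using that[of "insert c A" B] extend[OF A c] B AB V aA 1 notin[OF c] by auto
    next
      assume "\<forall>x \<in> B. c \<sim> x"
      then show ?thesis
        using that[of A "insert c B"] extend[OF B c] A AB V aA 1 notin[OF c] by auto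
    qed
  next
    case (2 c d)
    have C: "C = {c, d}"
    proof -
      have "e = c \<or> e = d" if e: "e \<in> C" for e
        using three_P1[of c d e] CC 2 e V by auto
      then show ?thesis using 2 by blast
    qed
    have cd: "x \<sim> c \<or> x \<sim> d" if "x \<in> A \<union> B" for x
      using three_P1[of x c d] CC[of c d] 2 that V notin by blast
    \<comment> \<open>Otherwise \<open>c\<close> and \<open>d\<close> are nonadjacent common
      neighbours of the edge from \<open>x\<close> to \<open>a\<close> or to \<open>b\<close>. With
      \<open>cd\<close>, each such \<open>x\<close> sees exactly one of \<open>c\<close> and
      \<open>d\<close>.\<close>
    have not_both: "\<not> (x \<sim> c \<and> x \<sim> d)" if "x \<in> A \<union> B - {a, b}" for x
    proof
      assume x: "x \<sim> c \<and> x \<sim> d"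
      have "x \<sim> a \<or> x \<sim> b" using that A B aA by (auto simp: clique_iff)
      then show False
        using diamond[of x a c d] diamond[of x b c d] x CC[of c d] Ca 2 sym by blast
    qed
    have "((\<forall>x \<in> A. c \<sim> x) \<and> (\<forall>x \<in> B. d \<sim> x)) \<or> ((\<forall>x \<in> A. d \<sim> x) \<and> (\<forall>x \<in> B. c \<sim> x))"
    proof -
      \<comment> \<open>If \<open>c\<close> sees only \<open>q\<close> in \<open>Q\<close>, then
        \<open>cd\<close> gives the rest of \<open>Q\<close> to \<open>d\<close>, and the dichotomy
        for \<open>d\<close> adds \<open>q\<close>.\<close>
      have alt: "(\<forall>x \<in> Q. c \<sim> x) \<or> (\<forall>x \<in> Q. d \<sim> x)"
        if "\<And>e. e \<in> C \<Longrightarrow> (\<forall>x \<in> Q. e \<sim> x) \<or> (\<forall>x \<in> Q - {q}. \<not> e \<sim> x)"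
          "Q \<subseteq> A \<union> B" "c \<sim> q" for Q q
        using that cd 2 sym by blast
      have AA: "(\<forall>x \<in> A. c \<sim> x) \<or> (\<forall>x \<in> A. d \<sim> x)"
        using alt[of A a] dichA Ca notin 2 by blast
      have BB: "(\<forall>x \<in> B. c \<sim> x) \<or> (\<forall>x \<in> B. d \<sim> x)"
        using alt[of B b] dichB Ca notin 2 by blast
      \<comment> \<open>The bad case is that one common neighbour \<open>e\<close> is complete to
        both sides. Further vertices \<open>x\<close> and \<open>y\<close> would then miss
        \<open>f\<close>, hence be adjacent, and the edge \<open>xe\<close> would have the
        nonadjacent common neighbours \<open>a\<close> and \<open>y\<close>.\<close>
      have trivial: "A = {a} \<or> B = {b}"
        if ef: "e \<in> C" "f \<in> C" "e \<noteq> f" "\<forall>x \<in> A \<union> B. e \<sim> x" for e f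
      proof (rule ccontr)
        assume "\<not> ?thesis"
        then obtain x y where xy: "x \<in> A" "x \<noteq> a" "y \<in> B" "y \<noteq> b" using aA by blast
        have ne: "x \<noteq> y" "x \<noteq> b" "y \<noteq> a" using xy AB aA by auto
        have "{e, f} = {c, d}" using ef C by auto
        then have "\<not> x \<sim> f" "\<not> y \<sim> f"
          using not_both[of x] not_both[of y] ef xy ne sym by (auto simp: doubleton_eq_iff)
        then have "x \<sim> y" using three_P1[of x y f] xy ne V ef notin by blast
        moreover have "x \<sim> a" "\<not> y \<sim> a" using xy A aA by (auto simp: clique_iff B_def)
        ultimately show False
          using diamond[of x e a y] ef xy ne Ca sym by blast
      qed
      show ?thesis
      proof (cases "\<forall>x \<in> A. c \<sim> x")
        case True
        show ?thesis
        proof (cases "\<forall>x \<in> B. d \<sim> x")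
          case False
          \<comment> \<open>Both \<open>c\<close> and \<open>d\<close> are complete to a singleton
            side, so they can still be sent to different sides.\<close>
          then have "A = {a} \<or> B = {b}" using trivial[of c d] True BB 2 by blast
          then show ?thesis using Ca 2 True BB False by auto
        qed (use True in blast)
      next
        case False
        then have dA: "\<forall>x \<in> A. d \<sim> x" using AA by blast
        show ?thesis
        proof (cases "\<forall>x \<in> B. c \<sim> x")
          case False
          then have "A = {a} \<or> B = {b}" using trivial[of d c] dA BB 2 by blast
          then show ?thesis using Ca 2 dA BB False by auto
        qed (use dA in blast)
      qed
    qed
    then show ?thesis
    proof
      assume *: "(\<forall>x \<in> A. c \<sim> x) \<and> (\<forall>x \<in> B. d \<sim> x)"
      show ?thesis
        using that[of "insert c A" "insert d B"] extend[OF A, of c] extend[OF B, of d]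
          * 2 C AB V aA notin by auto
    next
      assume *: "(\<forall>x \<in> A. d \<sim> x) \<and> (\<forall>x \<in> B. c \<sim> x)"
      show ?thesis
        using that[of "insert d A" "insert c B"] extend[OF A, of d] extend[OF B, of c]
          * 2 C AB V aA notin by auto
    qed
  qed
qed

text \<open>If \<open>v\<close> has two neighbours in \<open>Q2\<close>, then \<open>Q2 \<union> {v}\<close> is a clique with at least three
  vertices; one further edge to it would propagate to all of \<open>Q1 \<times> Q2\<close>.\<close>

lemma not_matching_imp_cut:
  assumes Q: "clique (with_proj G) Q1" "clique (with_proj G) Q2"
    and V: "pverts G = Q1 \<union> Q2" and disj: "Q1 \<inter> Q2 = {}"
    and v: "v \<in> Q1" "p \<in> Q2" "q \<in> Q2" "p \<noteq> q" "v \<sim> p" "v \<sim> q"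
    and ab: "a \<in> Q1" "b \<in> Q2" "\<not> a \<sim> b"
  shows "clique (with_proj G) (insert v Q2)" "a \<noteq> v"
    and "\<And>u w. u \<in> Q1 - {v} \<Longrightarrow> w \<in> Q2 \<Longrightarrow> \<not> u \<sim> w"
proof -
  have vQ: "v \<sim> w" if "w \<in> Q2" for w
    using clique_extend[OF Q(2) v(2-6)] that disj v by blast
  show Q2v: "clique (with_proj G) (insert v Q2)"
    using Q v V vQ by (auto simp: clique_iff intro: arcs_symmetric)
  show "a \<noteq> v" using vQ ab by blast
  then have "a \<sim> v" using Q(1) ab v by (auto simp: clique_iff)
  show "\<not> u \<sim> w" if u: "u \<in> Q1 - {v}" and w: "w \<in> Q2" for u w
  proof
    assume uw: "u \<sim> w"
    have uv: "u \<sim> v" using Q(1) u v by (auto simp: clique_iff)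
    \<comment> \<open>The clique rule is applied twice: \<open>u\<close> sees \<open>v\<close> and
      \<open>w\<close> in \<open>insert v Q2\<close>, and then \<open>b\<close> sees
      \<open>u\<close> and \<open>v\<close> in \<open>Q1\<close>.\<close>
    have "u \<sim> b"
      using clique_extend[OF Q2v, of v w u b] uw uv u w v ab disj by blast
    then have "b \<sim> u" "b \<sim> v" using vQ ab by (auto intro: arcs_symmetric)
    then have "b \<sim> a"
      using clique_extend[OF Q(1), of u v b a] u v ab disj by blast
    then show False using ab by (auto intro: arcs_symmetric)
  qed
qed

end

section \<open>Cut vertices of two overlapping cliques, and the converse direction\<close>

text \<open>Without \<open>v\<close> no walk starting at \<open>a\<close> leaves \<open>Q1\<close>,
  so \<open>v\<close> separates \<open>a\<close> from \<open>b\<close>. It lies in both cliques and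
  thus dominates the graph, which excludes any other cut vertex.\<close>

lemma (in pair_graph) ex1_cut_vertex:
  assumes conn: "Digraph_Component.connected (with_proj G)"
    and Q: "clique (with_proj G) Q1" "clique (with_proj G) Q2"
    and V: "pverts G = Q1 \<union> Q2" and v: "Q1 \<inter> Q2 = {v}"
    and ab: "a \<in> Q1 - {v}" "b \<in> Q2 - {v}"
    and no: "\<And>u w. u \<in> Q1 - {v} \<Longrightarrow> w \<in> Q2 - {v} \<Longrightarrow> \<not> u \<sim> w"
  shows "\<exists>!x. cut_vertex (with_proj G) x"
proof (rule ex1I)
  interpret D: wf_digraph "del_vert v" by (rule wf_digraph_del_vert)
  have "w \<in> Q1" if "a \<rightarrow>\<^sup>*\<^bsub>del_vert v\<^esub> w" for w
    using that
  proof (induction rule: D.reachable_induct)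
    case base
    then show ?case using ab by simp
  next
    case (step x y)
    then have "x \<sim> y" "x \<noteq> v" "y \<noteq> v" by (simp_all add: adj_del_vert_iff)
    then show ?case using step no V wellformed'(2) by blast
  qed
  then have "\<not> a \<rightarrow>\<^sup>*\<^bsub>del_vert v\<^esub> b" using ab v by blast
  moreover have "strongly_connected (with_proj G)"
    using symmetric_connected_imp_strongly_connected[OF pair_sym_arcs conn] .
  ultimately show "cut_vertex (with_proj G) v"
    unfolding cut_vertex_def strongly_connected_def using V v ab
    by (intro conjI bexI[of _ a] bexI[of _ b]) auto
next
  have "v \<in> Q1" "v \<in> Q2" using v by blast+
  then show "x = v" if "cut_vertex (with_proj G) x" for x
    using that Q V by (intro dominating_vertex_imp_only_cut_vertex) (auto simp: clique_iff)
qed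

text \<open>Every common vertex dominates the graph, so it must be \<open>x\<close>. An edge between
  the remainders of the cliques would keep the graph connected after deleting
  \<open>x\<close>.\<close>

lemma (in pair_graph) cut_vertex_two_cliques:
  assumes Q: "clique (with_proj G) Q1" "clique (with_proj G) Q2"
    and V: "pverts G = Q1 \<union> Q2" and ne: "Q1 \<inter> Q2 \<noteq> {}"
    and cut: "cut_vertex (with_proj G) x"
  shows "Q1 \<inter> Q2 = {x}" "\<And>u v. u \<in> Q1 - {x} \<Longrightarrow> v \<in> Q2 - {x} \<Longrightarrow> \<not> u \<sim> v"
proof -
  have "x = z" if "z \<in> Q1 \<inter> Q2" for z
    using that Q V cut by (intro dominating_vertex_imp_only_cut_vertex) (auto simp: clique_iff)
  then show x: "Q1 \<inter> Q2 = {x}" using ne by blast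
  interpret D: wf_digraph "del_vert x" by (rule wf_digraph_del_vert)
  obtain s t where st: "s \<in> pverts G" "s \<noteq> x" "t \<in> pverts G" "t \<noteq> x"
    "\<not> s \<rightarrow>\<^sup>*\<^bsub>del_vert x\<^esub> t"
    using cut by (auto simp: cut_vertex_def)
  have same: "u \<rightarrow>\<^sup>*\<^bsub>del_vert x\<^esub> v"
    if "clique (with_proj G) Q'" "u \<in> Q' - {x}" "v \<in> Q' - {x}" for Q' u v
  proof (cases "u = v")
    case True
    then show ?thesis using that by (auto simp: verts_del_vert clique_iff)
  next
    case False
    then show ?thesis
      using that by (intro D.reachable_adjI) (auto simp: adj_del_vert_iff clique_iff)
  qed
  fix u v assume uv: "u \<in> Q1 - {x}" "v \<in> Q2 - {x}"
  show "\<not> u \<sim> v"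
  proof
    assume "u \<sim> v"
    then have "u \<rightarrow>\<^bsub>del_vert x\<^esub> v" "v \<rightarrow>\<^bsub>del_vert x\<^esub> u"
      using uv by (auto simp: adj_del_vert_iff intro: arcs_symmetric)
    then have E: "u \<rightarrow>\<^sup>*\<^bsub>del_vert x\<^esub> v" "v \<rightarrow>\<^sup>*\<^bsub>del_vert x\<^esub> u" by blast+
    have "w \<rightarrow>\<^sup>*\<^bsub>del_vert x\<^esub> u \<and> u \<rightarrow>\<^sup>*\<^bsub>del_vert x\<^esub> w"
      if w: "w \<in> pverts G" "w \<noteq> x" for w
    proof (cases "w \<in> Q1")
      case True
      then show ?thesis using same[OF Q(1)] uv w by blast
    next
      case False
      then have "w \<in> Q2 - {x}" using w V by blast
      then show ?thesis using same[OF Q(2)] uv E D.reachable_trans by blast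
    qed
    then show False using st D.reachable_trans by blast
  qed
qed

text \<open>Of three vertices two lie in a common clique, which excludes \<open>three_P1\<close>. In
  a diamond the nonadjacent pair must be split between the cliques, so \<open>D\<close> treats only
  that case, up to symmetry.\<close>

lemma (in pair_graph) three_P1_diamond_freeI:
  assumes Q: "clique (with_proj G) Q1" "clique (with_proj G) Q2"
    and V: "pverts G = Q1 \<union> Q2"
    and D: "\<And>x y u v. \<lbrakk>u \<in> Q1 - Q2; v \<in> Q2 - Q1; x \<sim> y; x \<sim> u; x \<sim> v; y \<sim> u; y \<sim> v\<rbrakk> \<Longrightarrow> u \<sim> v"
  shows "three_P1_diamond_free G"
proof
  show "x \<sim> y \<or> x \<sim> z \<or> y \<sim> z"
    if "x \<in> pverts G" "y \<in> pverts G" "z \<in> pverts G" "x \<noteq> y" "x \<noteq> z" "y \<noteq> z" for x y z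
    using that Q unfolding V clique_iff by blast
  show "u \<sim> v" if *: "x \<sim> y" "x \<sim> u" "x \<sim> v" "y \<sim> u" "y \<sim> v" "u \<noteq> v" for x y u v
  proof -
    have "u \<in> Q1 \<union> Q2" "v \<in> Q1 \<union> Q2" using * wellformed' V by blast+
    then consider "u \<in> Q1" "v \<in> Q1" | "u \<in> Q2" "v \<in> Q2" | "u \<in> Q1 - Q2" "v \<in> Q2 - Q1"
      | "v \<in> Q1 - Q2" "u \<in> Q2 - Q1"
      by blast
    then show ?thesis
    proof cases
      case 3
      then show ?thesis using D * by blast
    next
      case 4
      then have "v \<sim> u" using D[of v u x y] * by blast
      then show ?thesis by (rule arcs_symmetric)
    qed (use Q * in \<open>auto simp: clique_iff\<close>)
  qed
qed

section \<open>Both directions of the characterization\<close>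

theorem theorem4:
  fixes G :: "'a pair_pre_digraph"
  assumes "pair_graph G"
    and "Digraph_Component.connected (with_proj G)"
    and "card (pverts G) \<ge> 4"
    and "\<not> complete_digraph (card (pverts G)) (with_proj G)"
    and "\<not> digraph_iso (with_proj C5) (with_proj G)"
  shows "free_of {three_P1, diamond} G \<longleftrightarrow>
    diam (with_proj G) \<le> 3 \<and>
    ((\<exists>Q1 Q2. clique (with_proj G) Q1 \<and> clique (with_proj G) Q2 \<and>
        pverts G = Q1 \<union> Q2 \<and> Q1 \<inter> Q2 \<noteq> {} \<and> (\<exists>!x. cut_vertex (with_proj G) x)) \<or>
     (\<exists>Q1 Q2. clique (with_proj G) Q1 \<and> clique (with_proj G) Q2 \<and>
        pverts G = Q1 \<union> Q2 \<and> Q1 \<inter> Q2 = {} \<and> matching (edges_between (with_proj G) Q1 Q2)))"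
    (is "_ \<longleftrightarrow> _ \<and> (?cut \<or> ?matching)")
proof -
  interpret pair_graph G by fact
  have sym: "u \<sim> v \<Longrightarrow> v \<sim> u" for u v by (rule arcs_symmetric)
  show ?thesis
    unfolding free_of_iff
  proof
    assume "three_P1_diamond_free G"
    then interpret three_P1_diamond_free G .
    have "graph (with_proj G)" by (rule pair_graphD_graph)
    with assms(4) obtain a b where "a \<in> pverts G" "b \<in> pverts G" "a \<noteq> b" "\<not> a \<sim> b"
      by (auto simp: complete_digraph_def dest: wellformed' no_loops')
    then obtain Q1 Q2 where Q: "clique (with_proj G) Q1" "clique (with_proj G) Q2"
      and V: "pverts G = Q1 \<union> Q2" "Q1 \<inter> Q2 = {}" and ab: "a \<in> Q1" "b \<in> Q2" "\<not> a \<sim> b"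
      using two_cliques assms(5) by metis
    have V': "pverts G = Q2 \<union> Q1" "Q2 \<inter> Q1 = {}" and ba: "\<not> b \<sim> a"
      using V ab sym by blast+
    \<comment> \<open>Stated for arbitrary \<open>P\<close> and \<open>R\<close> because either
      clique may contain the vertex \<open>v\<close> with two neighbours opposite. Adding
      \<open>v\<close> to \<open>R\<close> turns the disjoint cliques into overlapping ones;
      \<open>p\<close> and \<open>r\<close> are the vertices that \<open>v\<close>
      separates.\<close>
    have cutI: ?cut
      if "clique (with_proj G) P" "clique (with_proj G) (insert v R)"
        "pverts G = P \<union> R" "P \<inter> R = {}" "v \<in> P" "p \<in> P" "p \<noteq> v" "r \<in> R"
        "\<And>u w. u \<in> P - {v} \<Longrightarrow> w \<in> R \<Longrightarrow> \<not> u \<sim> w" for P R v p r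
    proof -
      have "pverts G = P \<union> insert v R" "P \<inter> insert v R = {v}" using that by auto
      moreover from this have "\<exists>!x. cut_vertex (with_proj G) x"
        using that by (intro ex1_cut_vertex[OF assms(2), of P "insert v R" v p r]) auto
      ultimately show ?thesis
        using that(1,2) by (intro exI[of _ P] exI[of _ "insert v R"]) simp
    qed
    have "?cut \<or> matching (edges_between (with_proj G) Q1 Q2)"
    proof (rule disjCI)
      assume "\<not> matching (edges_between (with_proj G) Q1 Q2)"
      then obtain u u' v v' where "u \<in> Q1" "u' \<in> Q1" "v \<in> Q2" "v' \<in> Q2" "u \<sim> v" "u' \<sim> v'"
        "(u = u' \<and> v \<noteq> v') \<or> (u \<noteq> u' \<and> v = v')"
        unfolding matching_edges_between_iff[OF V(2)] by blast
      then consider "u \<in> Q1" "v \<in> Q2" "v' \<in> Q2" "v \<noteq> v'" "u \<sim> v" "u \<sim> v'"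
        | "v \<in> Q2" "u \<in> Q1" "u' \<in> Q1" "u \<noteq> u'" "v \<sim> u" "v \<sim> u'"
        using sym by blast
      then show ?cut
      proof cases
        case 1
        note n = not_matching_imp_cut[OF Q V 1 ab]
        show ?thesis by (rule cutI[OF Q(1) n(1) V 1(1) ab(1) n(2) ab(2) n(3)])
      next
        case 2
        note n = not_matching_imp_cut[OF Q(2,1) V' 2 ab(2,1) ba]
        show ?thesis by (rule cutI[OF Q(2) n(1) V' 2(1) ab(2) n(2) ab(1) n(3)])
      qed
    qed
    then have "?cut \<or> ?matching" using Q V by blast
    moreover have "diam (with_proj G) \<le> 3"
      by (rule diam_le_3_if_two_cliques[OF assms(2) Q V(1)])
    ultimately show "diam (with_proj G) \<le> 3 \<and> (?cut \<or> ?matching)" by blast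
  next
    assume "diam (with_proj G) \<le> 3 \<and> (?cut \<or> ?matching)"
    then consider ?cut | ?matching by blast
    then show "three_P1_diamond_free G"
    proof cases
      case 1
      then obtain Q1 Q2 x where Q: "clique (with_proj G) Q1" "clique (with_proj G) Q2"
        and V: "pverts G = Q1 \<union> Q2" "Q1 \<inter> Q2 \<noteq> {}" and x: "cut_vertex (with_proj G) x"
        by blast
      note c = cut_vertex_two_cliques[OF Q V x]
      \<comment> \<open>Any other \<open>y\<close> would have an edge that crosses between the
        cliques and avoids \<open>x\<close>.\<close>
      have only: "y = x" if "u \<in> Q1 - Q2" "v \<in> Q2 - Q1" "y \<sim> u" "y \<sim> v" for u v y
      proof (rule ccontr)
        assume "y \<noteq> x"
        moreover have "y \<in> Q1 \<union> Q2" "u \<noteq> x" "v \<noteq> x"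
          using that V(1) c(1) wellformed'(1) by blast+
        ultimately show False using c(2)[of y v] c(2)[of u y] that sym by blast
      qed
      show ?thesis
        using Q V(1)
      proof (rule three_P1_diamond_freeI)
        fix y z u v assume "u \<in> Q1 - Q2" "v \<in> Q2 - Q1"
          "y \<sim> z" "y \<sim> u" "y \<sim> v" "z \<sim> u" "z \<sim> v"
        \<comment> \<open>Both ends of the central edge of the diamond would be the cut
          vertex.\<close>
        then have "x \<sim> x" using only[of u v y] only[of u v z] by blast
        then show "u \<sim> v" using no_loops' by blast
      qed
    next
      case 2
      then obtain Q1 Q2 where Q: "clique (with_proj G) Q1" "clique (with_proj G) Q2"
        and V: "pverts G = Q1 \<union> Q2" "Q1 \<inter> Q2 = {}"
        and m: "matching (edges_between (with_proj G) Q1 Q2)"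
        by blast
      have M: "u = u' \<longleftrightarrow> v = v'"
        if "u \<in> Q1" "u' \<in> Q1" "v \<in> Q2" "v' \<in> Q2" "u \<sim> v" "u' \<sim> v'" for u u' v v'
        using m that unfolding matching_edges_between_iff[OF V(2)] by blast
      show ?thesis
        using Q V(1)
      proof (rule three_P1_diamond_freeI)
        fix x y u v assume uv: "u \<in> Q1 - Q2" "v \<in> Q2 - Q1"
          and E: "x \<sim> y" "x \<sim> u" "x \<sim> v" "y \<sim> u" "y \<sim> v"
        have ne: "x \<noteq> y" "x \<noteq> u" "x \<noteq> v" "y \<noteq> u" "y \<noteq> v" using E no_loops' by blast+
        have "x \<in> Q1 \<union> Q2" "y \<in> Q1 \<union> Q2" using E wellformed' V(1) by blast+
        \<comment> \<open>In each case two different crossing edges share an end: \<open>v\<close>,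
          \<open>u\<close>, \<open>x\<close> and \<open>y\<close> respectively.\<close>
        then consider "x \<in> Q1" "y \<in> Q1" | "x \<in> Q2" "y \<in> Q2" | "x \<in> Q1" "y \<in> Q2"
          | "x \<in> Q2" "y \<in> Q1" by blast
        then have False
        proof cases
          case 1
          then show False using M[of x y v v] E ne uv by blast
        next
          case 2
          then show False using M[of u u x y] E ne uv sym by blast
        next
          case 3
          then show False using M[of x x y v] E ne uv by blast
        next
          case 4
          then show False using M[of y y x v] E ne uv sym by blast
        qed
        then show "u \<sim> v" ..
      qed
    qed
  qed
qed

end
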